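(* Let $A\in M_n(\mathbb R)$ be a generic matrix such that $1\notin\mathrm{Spec}^a(A)$. If $c^a(A)$ is even, then the absolute value equation $z-A|z|=b$ has a solution $z\in\mathbb R^n$ for every $b\in\mathbb R^n$.
   Context: $M_n(\mathbb R)$ is the space of real $n\times n$ matrices and $|\cdot|$ denotes the componentwise absolute value on $\mathbb R^n$. $\mathcal S_n$ is the set of sign matrices, i.e. diagonal $n\times n$ matrices with all diagonal entries in $\{-1,+1\}$. An aligned trio of $A$ is a triple $(\lambda,S,v)$ with $\lambda\ge 0$ real, $S\in\mathcal S_n$, $v\in\mathbb R^n_{\ge 0}$, $\|v\|_2=1$, and $SAv=\lambda v$. Then $\lambda$ is called an aligned value of $A$. The aligned spectrum $\mathrm{Spec}^a(A)$ is the set of aligned values of $A$. $A$ is generic if for every aligned trio $(\lambda,S,v)$ of $A$, $\lambda$ is a simple eigenvalue of $SA$ and $v$ is strictly positive (all entries $>0$). For generic $A$, the multiplicity of an aligned value $\lambda$ is the number of pairs $(S,v)$ such that $(\lambda,S,v)$ is an aligned trio of $A$. The aligned count $c^a(A)$ is the number of aligned values $\lambda>1$ of $A$, counted with multiplicity. *)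

theory Defs
  imports "HOL-Analysis.Analysis" "HOL-Computational_Algebra.Polynomial"
begin

definition sign_matrices :: "(real^'n^'n) set" where
  "sign_matrices = {S. (\<forall>i j. i \<noteq> j \<longrightarrow> S $ i $ j = 0) \<and> (\<forall>i. S $ i $ i \<in> {-1, 1})}"

definition charpoly :: "real^'n^'n \<Rightarrow> real poly" where
  "charpoly M = det (\<chi> i j. (if i = j then [:0, 1:] else 0) - [:M $ i $ j:])"

(* "Simple" refers to algebraic multiplicity. *)
definition simple_eigenvalue :: "real^'n^'n \<Rightarrow> real \<Rightarrow> bool" where
  "simple_eigenvalue M l \<longleftrightarrow> order l (charpoly M) = 1"

(* The norm on real^'n is the Euclidean one. *)
definition aligned_trio :: "real^'n^'n \<Rightarrow> real \<Rightarrow> real^'n^'n \<Rightarrow> real^'n \<Rightarrow> bool" where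
  "aligned_trio A l S v \<longleftrightarrow>
     0 \<le> l \<and> S \<in> sign_matrices \<and> (\<forall>i. 0 \<le> v $ i) \<and> norm v = 1 \<and>
     (S ** A) *v v = l *\<^sub>R v"

definition aligned_spectrum :: "real^'n^'n \<Rightarrow> real set" where
  "aligned_spectrum A = {l. \<exists>S v. aligned_trio A l S v}"

definition generic :: "real^'n^'n \<Rightarrow> bool" where
  "generic A \<longleftrightarrow>
     (\<forall>l S v. aligned_trio A l S v \<longrightarrow>
        simple_eigenvalue (S ** A) l \<and> (\<forall>i. 0 < v $ i))"

(* Meaningful for generic A only: there are finitely many sign matrices S, and simplicity of l
   leaves at most one nonnegative unit vector v for each S, so the set of pairs is finite and
   card is its true cardinality. *)
definition aligned_multiplicity :: "real^'n^'n \<Rightarrow> real \<Rightarrow> nat" where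
  "aligned_multiplicity A l = card {(S, v). aligned_trio A l S v}"

(* The index set is finite, since every aligned value is an eigenvalue of one of the finitely
   many matrices S ** A; the sum is therefore a genuine finite sum. *)
definition aligned_count :: "real^'n^'n \<Rightarrow> nat" where
  "aligned_count A = (\<Sum>l\<in>{l \<in> aligned_spectrum A. 1 < l}. aligned_multiplicity A l)"

end

theory Submission
  imports Defs
begin

text \<open>
  Deform the equation along \<open>z - t A \<bar>z\<bar> = b\<close>, \<open>0 \<le> t \<le> 1\<close>, and write \<open>z = S v\<close> with \<open>v \<ge> 0\<close>, so that
  \<open>(S - t A) v = b\<close>; by Cramer's rule the sign pattern of \<open>v\<close> is governed by finitely many
  polynomials in \<open>t\<close>. For almost every \<open>b\<close>, the number of solutions \<open>v > 0\<close>, summed over all \<open>S\<close>,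
  changes its parity only where a solution escapes to infinity. This happens at \<open>t = 1 / \<lambda>\<close> for an
  aligned trio \<open>(\<lambda>, S, v)\<close>, and simplicity of \<open>\<lambda>\<close> means that exactly one solution is then gained or
  lost. At \<open>t = 0\<close> there is one solution, so if \<open>c\<^sup>a(A)\<close> is even, the number of solutions is odd for
  \<open>t\<close> close to \<open>1\<close>. Compactness, together with \<open>1 \<notin> Spec\<^sup>a(A)\<close>, yields solutions at \<open>t = 1\<close> and for all \<open>b\<close>.
\<close>

section \<open>Sign matrices and the pencil\<close>

text \<open>Encoding a sign matrix by the set of its negative positions makes the sign patterns a
  finite type, so sums over all sign matrices become sums over \<open>UNIV\<close>.\<close>

definition sgn_of :: "'n set \<Rightarrow> 'n \<Rightarrow> real" where
  "sgn_of T i = (if i \<in> T then -1 else 1)"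

definition sgn_mat :: "'n set \<Rightarrow> real^'n^'n" where
  "sgn_mat T = (\<chi> i j. if i = j then sgn_of T i else 0)"

definition flip :: "'n \<Rightarrow> 'n set \<Rightarrow> 'n set" where
  "flip i T = (if i \<in> T then T - {i} else insert i T)"

definition pencil :: "real^'n^'n \<Rightarrow> 'n set \<Rightarrow> real \<Rightarrow> real^'n^'n" where
  "pencil A T t = sgn_mat T - t *\<^sub>R A"

text \<open>Keeping \<open>t\<close> as an indeterminate turns all determinants into polynomials:
  they are continuous in \<open>t\<close>, have finitely many zeros unless identically zero, and
  allow factors to be divided out.\<close>

definition pencil_poly :: "real^'n^'n \<Rightarrow> 'n set \<Rightarrow> real poly^'n^'n" where
  "pencil_poly A T = (\<chi> i j. [:sgn_mat T $ i $ j, - (A $ i $ j):])"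

definition det_poly :: "real^'n^'n \<Rightarrow> 'n set \<Rightarrow> real poly" where
  "det_poly A T = det (pencil_poly A T)"

definition cramer_poly :: "real^'n^'n \<Rightarrow> real^'n \<Rightarrow> 'n set \<Rightarrow> 'n \<Rightarrow> real poly" where
  "cramer_poly A b T i = det (\<chi> r c. if c = i then [:b $ r:] else pencil_poly A T $ r $ c)"

definition cramer_vec :: "real^'n^'n \<Rightarrow> real^'n \<Rightarrow> 'n set \<Rightarrow> real \<Rightarrow> real^'n" where
  "cramer_vec A b T t = (\<chi> i. poly (cramer_poly A b T i) t)"

lemma sgn_of_square [simp]: "sgn_of T i * sgn_of T i = 1"
  by (simp add: sgn_of_def)

lemma sgn_of_nonzero [simp]: "sgn_of T i \<noteq> 0"
  by (simp add: sgn_of_def)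

lemma abs_sgn_of [simp]: "\<bar>sgn_of T i\<bar> = 1"
  by (simp add: sgn_of_def)

lemma sgn_mat_mult: "(sgn_mat T *v x) $ i = sgn_of T i * x $ i"
proof -
  have "(\<Sum>j\<in>UNIV. (if i = j then sgn_of T i else 0) * x $ j) =
        (\<Sum>j\<in>UNIV. if i = j then sgn_of T i * x $ j else 0)"
    by (rule sum.cong) auto
  then show ?thesis
    by (simp add: sgn_mat_def matrix_vector_mult_def)
qed

lemma sgn_mat_sgn_mat [simp]: "sgn_mat T *v (sgn_mat T *v x) = x"
  by (simp add: vec_eq_iff sgn_mat_mult mult.assoc[symmetric])

lemma sgn_mat_square: "sgn_mat T ** sgn_mat T = mat 1"
  by (simp add: matrix_eq matrix_vector_mul_assoc[symmetric])

lemma det_sgn_mat_square: "det (sgn_mat T) * det (sgn_mat T) = 1"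
  by (metis det_mul sgn_mat_square det_I)

lemma det_sgn_mat_nonzero [simp]: "det (sgn_mat T) \<noteq> 0"
  using det_sgn_mat_square[of T] by auto

lemma bij_sgn_mat: "bij_betw sgn_mat (UNIV :: 'n set set) (sign_matrices :: (real^'n^'n) set)"
proof (rule bij_betwI')
  fix T U :: "'n set"
  show "(sgn_mat T = sgn_mat U) = (T = U)"
  proof
    assume "sgn_mat T = sgn_mat U"
    then have eq: "sgn_mat T $ i $ i = sgn_mat U $ i $ i" for i by simp
    have "i \<in> T \<longleftrightarrow> i \<in> U" for i using eq[of i]
      by (cases "i \<in> T"; cases "i \<in> U") (auto simp: sgn_mat_def sgn_of_def)
    then show "T = U" by blast
  qed simp
next
  fix T :: "'n set"
  show "sgn_mat T \<in> (sign_matrices :: (real^'n^'n) set)"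
    by (simp add: sign_matrices_def sgn_mat_def sgn_of_def)
next
  fix S :: "real^'n^'n" assume "S \<in> sign_matrices"
  then have "S = sgn_mat {i. S $ i $ i = -1}"
    by (auto simp: sign_matrices_def sgn_mat_def sgn_of_def vec_eq_iff)
  then show "\<exists>T\<in>UNIV. S = sgn_mat T" by blast
qed

lemma flip_flip [simp]: "flip i (flip i T) = T"
  by (auto simp: flip_def)

lemma sgn_of_flip: "sgn_of (flip i T) j = (if j = i then - sgn_of T j else sgn_of T j)"
  by (cases "i \<in> T"; cases "j = i"; simp add: sgn_of_def flip_def)

section \<open>Evaluation of polynomial determinants and Cramer's rule\<close>

lemma poly_det:
  fixes M :: "('a::comm_ring_1 poly)^'n^'n"
  shows "poly (det M) x = det (\<chi> i j. poly (M $ i $ j) x)"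
proof -
  have "poly (of_int k) x = of_int k" for k :: int
    by (simp add: of_int_poly)
  then show ?thesis
    unfolding det_def by (simp only: poly_sum poly_mult poly_prod vec_lambda_beta)
qed

lemma pencil_mult: "pencil A T t *v x = sgn_mat T *v x - t *\<^sub>R (A *v x)"
  by (simp add: pencil_def matrix_vector_mult_diff_rdistrib scaleR_matrix_vector_assoc)

lemma poly_pencil_poly: "poly (pencil_poly A T $ i $ j) t = pencil A T t $ i $ j"
  by (simp add: pencil_poly_def pencil_def)

lemma poly_det_poly: "poly (det_poly A T) t = det (pencil A T t)"
  by (simp add: det_poly_def poly_det poly_pencil_poly)

lemma poly_cramer_poly:
  "poly (cramer_poly A b T i) t = det (\<chi> r c. if c = i then b $ r else pencil A T t $ r $ c)"
  by (simp add: cramer_poly_def poly_det if_distrib[where f="\<lambda>p. poly p t"] poly_pencil_poly cong: if_cong)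

text \<open>The two pencils differ only in a diagonal entry of column \<open>i\<close>, and that
  column is overwritten by \<open>b\<close>.\<close>

lemma cramer_poly_flip: "cramer_poly A b (flip i T) i = cramer_poly A b T i"
  unfolding cramer_poly_def
  by (rule arg_cong[where f=det])
    (simp add: vec_eq_iff pencil_poly_def sgn_mat_def sgn_of_flip)

lemma cramer_vec_eq:
  assumes "pencil A T t *v x = b"
  shows "cramer_vec A b T t = poly (det_poly A T) t *\<^sub>R x"
proof -
  have "poly (cramer_poly A b T i) t = x $ i * det (pencil A T t)" for i
    unfolding poly_cramer_poly assms[symmetric] by (rule cramer_lemma)
  then show ?thesis
    by (simp add: cramer_vec_def vec_eq_iff poly_det_poly)
qed

lemma det_poly_0: "poly (det_poly A T) 0 = det (sgn_mat T)"
  by (simp add: poly_det_poly pencil_def)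

lemma det_poly_nonzero: "det_poly A T \<noteq> 0"
  using det_poly_0[of A T] by auto

lemma cramer_poly_0: "poly (cramer_poly A b T i) 0 = det (sgn_mat T) * (sgn_of T i * b $ i)"
proof -
  have "pencil A T 0 *v (sgn_mat T *v b) = b"
    by (simp add: pencil_def)
  from arg_cong[OF cramer_vec_eq[OF this], of "\<lambda>v. v $ i"] show ?thesis
    by (simp add: cramer_vec_def det_poly_0 sgn_mat_mult)
qed

lemma eventually_poly_nonzero:
  fixes p :: "real poly"
  assumes "p \<noteq> 0"
  shows "\<forall>\<^sub>F x in at a. poly p x \<noteq> 0"
proof -
  have "\<not> a islimpt {x. poly p x = 0}"
    by (rule islimpt_finite[OF poly_roots_finite[OF assms]])
  then show ?thesis by (simp add: islimpt_iff_eventually)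
qed

lemma pencil_solvable:
  assumes "poly (det_poly A T) t \<noteq> 0"
  obtains x where "pencil A T t *v x = b" "cramer_vec A b T t = poly (det_poly A T) t *\<^sub>R x"
proof -
  have "\<exists>x. pencil A T t *v x = b"
    using cramer[of "pencil A T t"] assms by (simp add: poly_det_poly)
  then show ?thesis using that cramer_vec_eq by blast
qed

lemma isCont_cramer_vec: "isCont (cramer_vec A b T) t"
  unfolding cramer_vec_def isCont_def
  by (intro tendsto_vec_lambda) (metis isCont_def poly_isCont)

lemma continuous_pencil_apply:
  assumes "(f \<longlongrightarrow> l) (at t)"
  shows "((\<lambda>s. pencil A T s *v f s) \<longlongrightarrow> pencil A T t *v l) (at t)"
  unfolding pencil_mult
  by (intro tendsto_intros bounded_linear.tendsto[OF matrix_vector_mul_bounded_linear] assms)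

lemma pencil_singular:
  assumes "poly (det_poly A T) t = 0"
  obtains x where "x \<noteq> 0" "pencil A T t *v x = 0"
proof -
  have "\<not> invertible (pencil A T t)"
    using assms by (simp add: poly_det_poly invertible_det_nz)
  then have "\<exists>x. pencil A T t *v x = 0 \<and> x \<noteq> 0"
    unfolding invertible_left_inverse matrix_left_invertible_ker by blast
  then show ?thesis using that by blast
qed

lemma pencil_nonsingular:
  assumes "poly (det_poly A T) t \<noteq> 0" "pencil A T t *v x = pencil A T t *v y"
  shows "x = y"
  using cramer_vec_eq[OF assms(2)] cramer_vec_eq[OF refl, of A T t y] assms(1) by simp

section \<open>Aligned trios as kernel vectors of the pencil\<close>

lemma sgn_mat_mult_eq_iff: "sgn_mat T *v x = y \<longleftrightarrow> x = sgn_mat T *v y"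
  by (metis sgn_mat_sgn_mat)

text \<open>A sign matrix is its own inverse, so it can be moved to the other side of the eigenvalue
  equation; scaling by \<open>t\<close> then gives the pencil.\<close>

lemma aligned_trio_iff_pencil:
  assumes "0 < t"
  shows "aligned_trio A (1 / t) (sgn_mat T) v \<longleftrightarrow>
    (\<forall>i. 0 \<le> v $ i) \<and> norm v = 1 \<and> pencil A T t *v v = 0"
proof -
  have "(sgn_mat T ** A) *v v = (1 / t) *\<^sub>R v \<longleftrightarrow> A *v v = sgn_mat T *v ((1 / t) *\<^sub>R v)"
    unfolding matrix_vector_mul_assoc[symmetric] by (rule sgn_mat_mult_eq_iff)
  also have "\<dots> \<longleftrightarrow> A *v v = (1 / t) *\<^sub>R (sgn_mat T *v v)"
    by (simp add: matrix_vector_mult_scaleR)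
  also have "\<dots> \<longleftrightarrow> pencil A T t *v v = 0"
    using assms by (auto simp: pencil_mult vec_eq_iff field_simps)
  finally show ?thesis
    using assms bij_betwE[OF bij_sgn_mat] by (auto simp: aligned_trio_def)
qed

lemma aligned_trio_normalize:
  assumes "0 < t" "v \<noteq> 0" "\<forall>i. 0 \<le> v $ i" "pencil A T t *v v = 0"
  shows "aligned_trio A (1 / t) (sgn_mat T) (v /\<^sub>R norm v)"
  using assms by (simp add: aligned_trio_iff_pencil matrix_vector_mult_scaleR)

lemma generic_kernel_pos:
  assumes "generic A" "0 < t" "v \<noteq> 0" "\<forall>i. 0 \<le> v $ i" "pencil A T t *v v = 0"
  shows "0 < v $ i"
proof -
  have "0 < (v /\<^sub>R norm v) $ i"
    using aligned_trio_normalize[OF assms(2-)] \<open>generic A\<close> unfolding generic_def by blast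
  then show ?thesis using assms(3) by (simp add: zero_less_mult_iff)
qed

text \<open>Subtracting the largest admissible multiple of \<open>v\<close> from \<open>x\<close> leaves a nonnegative kernel
  vector with a vanishing entry, which genericity forbids unless it is zero.\<close>

lemma generic_kernel_line:
  fixes A :: "real^'n^'n"
  assumes "generic A" "0 < t" "v \<noteq> 0" "\<forall>i. 0 \<le> v $ i" "pencil A T t *v v = 0"
    and "pencil A T t *v x = 0"
  shows "\<exists>c. x = c *\<^sub>R v"
proof -
  have pos: "0 < v $ i" for i using generic_kernel_pos[OF assms(1-5)] .
  define c where "c = Min (range (\<lambda>i. x $ i / v $ i))"
  define y where "y = x - c *\<^sub>R v"
  have "c \<in> range (\<lambda>i. x $ i / v $ i)" unfolding c_def by (rule Min_in) auto
  then obtain k where k: "c = x $ k / v $ k" by blast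
  have "c \<le> x $ i / v $ i" for i unfolding c_def by (rule Min_le) auto
  then have "0 \<le> y $ i" for i using pos by (simp add: y_def pos_le_divide_eq)
  moreover have "y $ k = 0" using pos[of k] by (simp add: y_def k)
  moreover have "pencil A T t *v y = 0"
    by (simp add: y_def matrix_vector_mult_diff_distrib matrix_vector_mult_scaleR assms)
  ultimately have "y = 0"
    using generic_kernel_pos[OF assms(1,2), of y T k] by fastforce
  then show ?thesis by (auto simp: y_def)
qed

section \<open>From simple eigenvalues to simple zeros of the determinant\<close>

lemma poly_charpoly: "poly (charpoly M) x = det (mat x - M)"
  unfolding charpoly_def poly_det
  by (rule arg_cong[where f=det]) (simp add: vec_eq_iff mat_def)

lemma pencil_factor:
  fixes A :: "real^'n^'n"
  assumes "t \<noteq> 0"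
  shows "pencil A T t = (t *\<^sub>R sgn_mat T) ** (mat (1 / t) - sgn_mat T ** A)"
proof -
  have "mat (1 / t) *v x = (1 / t) *\<^sub>R x" for x :: "real^'n"
    by (simp add: vec_eq_iff mat_def matrix_vector_mult_def if_distrib[where f="\<lambda>a. a * _"] cong: if_cong)
  then show ?thesis
    using assms
    by (simp add: matrix_eq pencil_mult matrix_vector_mul_assoc[symmetric]
        matrix_vector_mult_diff_rdistrib matrix_vector_mult_diff_distrib
        scaleR_matrix_vector_assoc[symmetric] matrix_vector_mult_scaleR scaleR_diff_right)
qed

text \<open>The factor \<open>q\<close> is the determinant of \<open>t *\<^sub>R sgn_mat T\<close>.
  Away from zero it is invertible, so zeros of the two polynomials correspond under inversion of
  \<open>t\<close>.\<close>

lemma det_pencil_charpoly: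
  obtains q where "\<And>t. t \<noteq> 0 \<Longrightarrow> poly q t \<noteq> 0"
    and "\<And>t. t \<noteq> 0 \<Longrightarrow>
      poly (det_poly A T) t = poly q t * poly (charpoly (sgn_mat T ** A)) (1 / t)"
proof
  define q where "q = det (\<chi> i j. [:0, sgn_mat T $ i $ j:])"
  have q: "poly q t = det (t *\<^sub>R sgn_mat T)" for t
    unfolding q_def poly_det by (rule arg_cong[where f=det]) (simp add: vec_eq_iff)
  show "poly q t \<noteq> 0" if "t \<noteq> 0" for t
  proof -
    have "(t *\<^sub>R sgn_mat T) ** ((1 / t) *\<^sub>R sgn_mat T) = mat 1"
      using that by (simp add: matrix_eq matrix_vector_mul_assoc[symmetric]
          scaleR_matrix_vector_assoc[symmetric] matrix_vector_mult_scaleR)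
    then show ?thesis unfolding q by (metis det_mul det_I mult_zero_left zero_neq_one)
  qed
  show "poly (det_poly A T) t = poly q t * poly (charpoly (sgn_mat T ** A)) (1 / t)" if "t \<noteq> 0" for t
    unfolding poly_det_poly pencil_factor[OF that] det_mul q poly_charpoly ..
qed

lemma generic_det_simple_root:
  assumes "generic A" "0 < t" "aligned_trio A (1 / t) (sgn_mat T) v"
  obtains m where "det_poly A T = [:- t, 1:] * m" "poly m t \<noteq> 0"
proof -
  let ?\<chi> = "charpoly (sgn_mat T ** A)"
  obtain q where q: "\<And>s. s \<noteq> 0 \<Longrightarrow> poly q s \<noteq> 0"
    and eq: "\<And>s. s \<noteq> 0 \<Longrightarrow> poly (det_poly A T) s = poly q s * poly ?\<chi> (1 / s)"
    using det_pencil_charpoly by blast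
  \<comment> \<open>The order yields a factorization only for a nonzero polynomial. If this one were
    zero, the determinant would vanish in a punctured neighbourhood of 0.\<close>
  have nz: "?\<chi> \<noteq> 0"
  proof
    assume "?\<chi> = 0"
    then have "\<forall>\<^sub>F s in at 0. poly (det_poly A T) s = 0"
      by (simp add: eq eventually_at_filter)
    moreover have "\<forall>\<^sub>F s in at 0. poly (det_poly A T) s \<noteq> 0"
      by (rule eventually_poly_nonzero[OF det_poly_nonzero])
    ultimately have "\<forall>\<^sub>F s in at (0::real). False" by eventually_elim simp
    then show False by simp
  qed
  have "order (1 / t) ?\<chi> = 1"
    using assms unfolding generic_def simple_eigenvalue_def by blast
  then obtain g where g: "?\<chi> = [:- (1 / t), 1:] * g" "poly g (1 / t) \<noteq> 0"
    using order_decomp[OF nz, of "1 / t"] by (auto simp: poly_eq_0_iff_dvd)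
  have "poly (det_poly A T) t = 0" using assms(2) by (simp add: eq g)
  then obtain m where m: "det_poly A T = [:- t, 1:] * m" by (auto simp: poly_eq_0_iff_dvd)
  \<comment> \<open>This is what remains after cancelling \<open>s - t\<close>, since
    \<open>1 / s - 1 / t = - (s - t) / (s * t)\<close>. It agrees with \<open>m\<close> off
    \<open>t\<close>, so comparing limits gives the value of \<open>m\<close> at \<open>t\<close>,
    where \<open>s - t\<close> cannot be cancelled.\<close>
  let ?f = "\<lambda>s. - (poly q s * poly g (1 / s)) / (s * t)"
  have "\<forall>\<^sub>F s in at t. s > 0"
    using order_tendstoD(1)[OF tendsto_ident_at \<open>0 < t\<close>] by simp
  moreover have "\<forall>\<^sub>F s in at t. s \<noteq> t"
    by (rule eventually_neq_at_within)
  ultimately have "\<forall>\<^sub>F s in at t. ?f s = poly m s"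
  proof eventually_elim
    case (elim s)
    have "(s - t) * poly m s = poly q s * ((1 / s - 1 / t) * poly g (1 / s))"
      using elim eq[of s] by (simp add: m g algebra_simps)
    also have "\<dots> = (s - t) * ?f s"
      using elim assms(2) by (simp add: field_simps)
    finally have "s - t = 0 \<or> poly m s = ?f s" by (simp only: mult_cancel_left)
    then show ?case using elim by auto
  qed
  moreover have "(?f \<longlongrightarrow> ?f t) (at t)"
    using assms(2) by (intro tendsto_intros) auto
  ultimately have "(poly m \<longlongrightarrow> ?f t) (at t)"
    using Lim_transform_eventually by blast
  moreover have "(poly m \<longlongrightarrow> poly m t) (at t)"
    using isCont_def poly_isCont by blast
  ultimately have "poly m t = ?f t" by (intro tendsto_unique[of "at t"]) auto
  then have "poly m t \<noteq> 0" using q[of t] g assms(2) by simp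
  with m show ?thesis by (rule that)
qed

text \<open>The pair \<open>(v, h)\<close> is a projective solution: \<open>v / h\<close> solves the equation if \<open>h > 0\<close>, and \<open>h = 0\<close> is
  a solution at infinity.\<close>

definition nonneg_solvable :: "real^'n^'n \<Rightarrow> 'n set \<Rightarrow> (real \<times> (real^'n)) set" where
  "nonneg_solvable A T =
    {(t, b). \<exists>v h. (\<forall>i. 0 \<le> v $ i) \<and> 0 \<le> h \<and> (v, h) \<noteq> 0 \<and> pencil A T t *v v = h *\<^sub>R b}"

text \<open>The condition is homogeneous in \<open>(v, h)\<close>, so witnesses can be taken on the
  unit sphere; projecting a closed set along a compact factor keeps it closed.\<close>

lemma closed_nonneg_solvable:
  fixes A :: "real^'n^'n"
  shows "closed (nonneg_solvable A T)"
proof -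
  let ?C = "{w :: (real^'n) \<times> real. (\<forall>i. 0 \<le> fst w $ i) \<and> 0 \<le> snd w} \<inter> sphere 0 1"
  let ?E = "{z :: ((real^'n) \<times> real) \<times> real \<times> (real^'n).
    pencil A T (fst (snd z)) *v fst (fst z) = snd (fst z) *\<^sub>R snd (snd z)}"
  have "closed {w :: (real^'n) \<times> real. (\<forall>i. 0 \<le> fst w $ i) \<and> 0 \<le> snd w}"
    by (intro closed_Collect_conj closed_Collect_all closed_Collect_le continuous_intros)
  then have "compact ?C"
    by (intro closed_Int_compact compact_sphere)
  moreover have "closed ?E"
    unfolding pencil_mult
    by (intro closed_Collect_eq continuous_intros
        bounded_linear.continuous_on[OF matrix_vector_mul_bounded_linear])
  ultimately have "closed {y. \<exists>w. w \<in> ?C \<and> (w, y) \<in> ?E}"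
    by (rule closed_compact_projection)
  also have "{y. \<exists>w. w \<in> ?C \<and> (w, y) \<in> ?E} = nonneg_solvable A T"
  proof (intro equalityI subsetI)
    fix y assume "y \<in> {y. \<exists>w. w \<in> ?C \<and> (w, y) \<in> ?E}"
    then show "y \<in> nonneg_solvable A T"
      by (force simp: nonneg_solvable_def)
  next
    fix y assume "y \<in> nonneg_solvable A T"
    then obtain t b v h where y: "y = (t, b)" and *: "\<forall>i. 0 \<le> v $ i" "0 \<le> h" "(v, h) \<noteq> 0"
      "pencil A T t *v v = h *\<^sub>R b"
      by (auto simp: nonneg_solvable_def)
    let ?w = "(v, h) /\<^sub>R norm (v, h)"
    have "norm ?w = 1"
      using *(3) by (simp del: scaleR_Pair)
    then have "?w \<in> ?C"
      using *(1,2) by simp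
    moreover have "(?w, y) \<in> ?E"
      using * by (simp add: y matrix_vector_mult_scaleR)
    ultimately show "y \<in> {y. \<exists>w. w \<in> ?C \<and> (w, y) \<in> ?E}" by blast
  qed
  finally show ?thesis .
qed

section \<open>Counting solutions and aligned values\<close>

text \<open>By Cramer's rule the product has the sign of the \<open>i\<close>-th solution
  coordinate. It is zero when the pencil is singular, so such parameters count no solution.\<close>

definition pos_count :: "real^'n^'n \<Rightarrow> real^'n \<Rightarrow> 'n set \<Rightarrow> real \<Rightarrow> nat" where
  "pos_count A b T t = of_bool (\<forall>i. 0 < poly (cramer_poly A b T i) t * poly (det_poly A T) t)"

definition aligned_vals :: "real^'n^'n \<Rightarrow> 'n set \<Rightarrow> real set" where
  "aligned_vals A T = {l. \<exists>v. aligned_trio A l (sgn_mat T) v}"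

text \<open>Writing the threshold as \<open>1 < l * t\<close> avoids dividing by \<open>t\<close>:
  the count is 0 at \<open>t = 0\<close>, and at \<open>t = 1\<close> it records the aligned values
  above 1.\<close>

definition aligned_below :: "real^'n^'n \<Rightarrow> 'n set \<Rightarrow> real \<Rightarrow> nat" where
  "aligned_below A T t = card {l \<in> aligned_vals A T. 1 < l * t}"

text \<open>A solution passes through infinity at \<open>t = 1 / l\<close> for each aligned value \<open>l\<close>; adding the number
  of those already passed compensates for the change of parity.\<close>

definition total_count :: "real^'n^'n \<Rightarrow> real^'n \<Rightarrow> 'n set \<Rightarrow> real \<Rightarrow> nat" where
  "total_count A b T t = pos_count A b T t + aligned_below A T t"

text \<open>The first condition makes the start at \<open>t = 0\<close> nondegenerate, the second
  leaves singular pencils only solutions at infinity, and the third lets solutions meet the boundary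
  of an orthant only inside facets.\<close>

definition regular_rhs :: "real^'n^'n \<Rightarrow> real^'n \<Rightarrow> bool" where
  "regular_rhs A b \<longleftrightarrow> (\<forall>i. b $ i \<noteq> 0) \<and>
    (\<forall>T t v. poly (det_poly A T) t = 0 \<longrightarrow> pencil A T t *v v \<noteq> b) \<and>
    (\<forall>T t v i j. pencil A T t *v v = b \<longrightarrow> v $ i = 0 \<longrightarrow> v $ j = 0 \<longrightarrow> i = j)"

text \<open>The point \<open>a\<close> itself is excluded because a solution lying on a facet or at
  infinity is not counted there.\<close>

definition parity_stable :: "real \<Rightarrow> (real \<Rightarrow> nat) \<Rightarrow> bool" where
  "parity_stable a f \<longleftrightarrow> (\<exists>c. \<forall>\<^sub>F t in at a. even (f t) = c)"

lemma parity_stableI: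
  assumes "\<forall>\<^sub>F t in at a. f t = k"
  shows "parity_stable a f"
  unfolding parity_stable_def using eventually_mono[OF assms] by (metis (mono_tags, lifting))

lemma parity_stable_sum:
  assumes "finite I" "\<And>i. i \<in> I \<Longrightarrow> parity_stable a (f i)"
  shows "parity_stable a (\<lambda>t. \<Sum>i\<in>I. f i t)"
  using assms
proof (induction I rule: finite_induct)
  case empty
  then show ?case by (intro parity_stableI[where k=0]) simp
next
  case (insert x I)
  then obtain c d where "\<forall>\<^sub>F t in at a. even (f x t) = c" "\<forall>\<^sub>F t in at a. even (\<Sum>i\<in>I. f i t) = d"
    unfolding parity_stable_def by blast
  then have "\<forall>\<^sub>F t in at a. even (\<Sum>i\<in>insert x I. f i t) = (c = d)"
    by eventually_elim (use insert in auto)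
  then show ?case unfolding parity_stable_def by blast
qed

lemma parity_stable_add:
  assumes "parity_stable a f" "parity_stable a g"
  shows "parity_stable a (\<lambda>t. f t + g t)"
proof -
  obtain c d where "\<forall>\<^sub>F t in at a. even (f t) = c" "\<forall>\<^sub>F t in at a. even (g t) = d"
    using assms unfolding parity_stable_def by blast
  then have "\<forall>\<^sub>F t in at a. even (f t + g t) = (c = d)"
    by eventually_elim auto
  then show ?thesis unfolding parity_stable_def by blast
qed

section \<open>Aligned values crossing the threshold\<close>

lemma aligned_vals_kernel:
  assumes "l \<in> aligned_vals A T" "l * t = 1"
  obtains v where "0 < t" "v \<noteq> 0" "\<forall>i. 0 \<le> v $ i" "pencil A T t *v v = 0"
proof -
  obtain v where v: "aligned_trio A l (sgn_mat T) v" using assms by (auto simp: aligned_vals_def)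
  then have "0 \<le> l" by (simp add: aligned_trio_def)
  have "0 < l * t" using assms(2) by simp
  then have "0 < t" using \<open>0 \<le> l\<close> by (simp add: zero_less_mult_iff)
  then have "l = 1 / t" using assms(2) by (simp add: field_simps)
  then have *: "\<forall>i. 0 \<le> v $ i" "norm v = 1" "pencil A T t *v v = 0"
    using v \<open>0 < t\<close> by (simp_all add: aligned_trio_iff_pencil)
  then have "v \<noteq> 0" by auto
  with * \<open>0 < t\<close> show ?thesis using that by blast
qed

lemma finite_aligned_vals: "finite (aligned_vals A T)"
proof (rule finite_subset)
  show "aligned_vals A T \<subseteq> insert 0 ((\<lambda>t. 1 / t) ` {t. poly (det_poly A T) t = 0})"
  proof
    fix l assume l: "l \<in> aligned_vals A T"
    show "l \<in> insert 0 ((\<lambda>t. 1 / t) ` {t. poly (det_poly A T) t = 0})"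
    proof (cases "l = 0")
      case False
      then obtain v where "v \<noteq> 0" "pencil A T (1 / l) *v v = 0"
        using aligned_vals_kernel[OF l, of "1 / l"] by auto
      then have "poly (det_poly A T) (1 / l) = 0"
        using pencil_nonsingular[of A T "1 / l" v 0] by auto
      then show ?thesis by (intro insertI2 image_eqI[of _ _ "1 / l"]) auto
    qed simp
  qed
  show "finite (insert 0 ((\<lambda>t. 1 / t) ` {t. poly (det_poly A T) t = 0}))"
    by (intro finite.insertI finite_imageI poly_roots_finite det_poly_nonzero)
qed

lemma eventually_same_side:
  fixes f :: "real \<Rightarrow> real"
  assumes "(f \<longlongrightarrow> y) F" "y \<noteq> c"
  shows "\<forall>\<^sub>F t in F. (c < f t) = (c < y)"
proof (cases "c < y")
  case True
  show ?thesis using order_tendstoD(1)[OF assms(1) True] by eventually_elim (use True in simp)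
next
  case False
  then have "y < c" using assms(2) by simp
  show ?thesis using order_tendstoD(2)[OF assms(1) \<open>y < c\<close>] by eventually_elim (use False in simp)
qed

lemma eventually_aligned_below:
  fixes a :: real
  shows "\<forall>\<^sub>F t in at a. \<forall>l \<in> {l \<in> aligned_vals A T. l * a \<noteq> 1}. (1 < l * t) = (1 < l * a)"
proof (intro eventually_ball_finite ballI)
  show "finite {l \<in> aligned_vals A T. l * a \<noteq> 1}"
    by (simp add: finite_aligned_vals)
  fix l assume "l \<in> {l \<in> aligned_vals A T. l * a \<noteq> 1}"
  then show "\<forall>\<^sub>F t in at a. (1 < l * t) = (1 < l * a)"
    by (intro eventually_same_side tendsto_intros) auto
qed

lemma aligned_below_stable:
  assumes "\<forall>l \<in> aligned_vals A T. l * a \<noteq> 1"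
  shows "\<forall>\<^sub>F t in at a. aligned_below A T t = aligned_below A T a"
  using eventually_aligned_below[where a=a and A=A and T=T]
proof eventually_elim
  case (elim t)
  then have "{l \<in> aligned_vals A T. 1 < l * t} = {l \<in> aligned_vals A T. 1 < l * a}"
    using assms by blast
  then show ?case by (simp add: aligned_below_def)
qed

text \<open>Only \<open>1 / a\<close> meets the threshold at \<open>a\<close>; each of the finitely
  many other aligned values stays on its side.\<close>

lemma aligned_below_jump:
  assumes "0 < a" "1 / a \<in> aligned_vals A T"
  shows "\<forall>\<^sub>F t in at a. aligned_below A T t = aligned_below A T a + of_bool (a < t)"
  using eventually_aligned_below[where a=a and A=A and T=T]
proof eventually_elim
  case (elim t)
  have eq: "l * a = 1 \<longleftrightarrow> l = 1 / a" for l using assms(1) by (auto simp: field_simps)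
  have "{l \<in> aligned_vals A T. 1 < l * t} =
        {l \<in> aligned_vals A T. 1 < l * a} \<union> (if a < t then {1 / a} else {})"
  proof (intro set_eqI)
    fix l
    show "l \<in> {l \<in> aligned_vals A T. 1 < l * t} \<longleftrightarrow>
      l \<in> {l \<in> aligned_vals A T. 1 < l * a} \<union> (if a < t then {1 / a} else {})"
      using elim assms by (cases "l = 1 / a") (auto simp: eq)
  qed
  then show ?case
    using finite_aligned_vals[of A T] assms(1) by (auto simp: aligned_below_def)
qed

lemma cramer_vec_solves:
  assumes "poly (det_poly A T) t \<noteq> 0"
  shows "pencil A T t *v cramer_vec A b T t = poly (det_poly A T) t *\<^sub>R b"
  by (rule pencil_solvable[OF assms, of b]) (simp add: matrix_vector_mult_scaleR)

lemma pos_count_solvable: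
  assumes "pos_count A b T t \<noteq> 0"
  obtains v where "\<forall>i. 0 < v $ i" "pencil A T t *v v = b"
proof -
  have pos: "0 < poly (cramer_poly A b T i) t * poly (det_poly A T) t" for i
    using assms by (simp add: pos_count_def)
  then have nz: "poly (det_poly A T) t \<noteq> 0" by (metis less_irrefl mult_zero_right)
  then obtain v where v: "pencil A T t *v v = b"
    "cramer_vec A b T t = poly (det_poly A T) t *\<^sub>R v"
    using pencil_solvable by blast
  have "0 < v $ i" for i
  proof -
    have "poly (cramer_poly A b T i) t = poly (det_poly A T) t * v $ i"
      using arg_cong[OF v(2), of "\<lambda>x. x $ i"] by (simp add: cramer_vec_def)
    then have "0 < (poly (det_poly A T) t)\<^sup>2 * v $ i"
      using pos[of i] by (simp add: power2_eq_square mult_ac)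
    then show ?thesis using nz by (simp add: zero_less_mult_iff)
  qed
  then show ?thesis using v(1) that by blast
qed

lemma nonneg_solvableI:
  assumes "\<forall>i. 0 \<le> v $ i" "0 \<le> h" "v \<noteq> 0 \<or> h \<noteq> 0" "pencil A T t *v v = h *\<^sub>R b"
  shows "(t, b) \<in> nonneg_solvable A T"
  using assms unfolding nonneg_solvable_def by (auto simp: zero_prod_def)

lemma nonneg_solvableE:
  assumes "(t, b) \<in> nonneg_solvable A T"
  obtains v h where "\<forall>i. 0 \<le> v $ i" "0 \<le> h" "v \<noteq> 0 \<or> h \<noteq> 0" "pencil A T t *v v = h *\<^sub>R b"
  using assms unfolding nonneg_solvable_def by (auto simp: zero_prod_def)

lemma eventually_pos_count_0:
  assumes "(a, b) \<notin> nonneg_solvable A T"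
  shows "\<forall>\<^sub>F t in at a. pos_count A b T t = 0"
proof -
  have "\<forall>\<^sub>F t in at a. (t, b) \<in> - nonneg_solvable A T"
    using assms by (intro topological_tendstoD[where f="\<lambda>t. (t, b)" and l="(a, b)"] tendsto_intros)
      (auto simp: open_Compl closed_nonneg_solvable)
  then show ?thesis
  proof eventually_elim
    case (elim t)
    show ?case
    proof (rule ccontr)
      assume "pos_count A b T t \<noteq> 0"
      then obtain v where "\<forall>i. 0 < v $ i" "pencil A T t *v v = b" by (rule pos_count_solvable)
      then have "(t, b) \<in> nonneg_solvable A T"
        by (intro nonneg_solvableI[of v 1]) (auto simp: less_imp_le)
      with elim show False by simp
    qed
  qed
qed

text \<open>Closedness excludes solutions at nearby parameters, and an aligned value
  \<open>1 / a\<close> would itself be a solution at infinity.\<close>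

lemma stable_unsolvable:
  assumes "(a, b) \<notin> nonneg_solvable A T"
  shows "parity_stable a (total_count A b T)"
proof -
  have "\<forall>l \<in> aligned_vals A T. l * a \<noteq> 1"
  proof (intro ballI notI)
    fix l assume "l \<in> aligned_vals A T" "l * a = 1"
    then obtain v where "v \<noteq> 0" "\<forall>i. 0 \<le> v $ i" "pencil A T a *v v = 0"
      by (rule aligned_vals_kernel)
    then have "(a, b) \<in> nonneg_solvable A T"
      by (intro nonneg_solvableI[of v 0]) auto
    with assms show False by simp
  qed
  note ev1 = aligned_below_stable[OF this]
  have "\<forall>\<^sub>F t in at a. total_count A b T t = aligned_below A T a"
    using ev1 eventually_pos_count_0[OF assms] by eventually_elim (simp add: total_count_def)
  then show ?thesis by (rule parity_stableI)
qed

lemma tendsto_cramer_vec: "(cramer_vec A b T \<longlongrightarrow> cramer_vec A b T a) (at a)"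
  using isCont_cramer_vec isCont_def by blast

lemma tendsto_poly_at: "((\<lambda>t. poly p t) \<longlongrightarrow> poly p a) (at (a::real))"
  using isCont_def poly_isCont by blast

lemma tendsto_eq_at:
  fixes f g :: "real \<Rightarrow> 'b::t2_space"
  assumes "(f \<longlongrightarrow> x) (at a)" "(g \<longlongrightarrow> y) (at a)" "\<forall>\<^sub>F t in at a. f t = g t"
  shows "x = y"
  using Lim_transform_eventually[OF assms(1,3)] assms(2) by (intro tendsto_unique[of "at a"]) auto

text \<open>The determinant changes sign at its simple zero \<open>a\<close>, while the Cramer
  vector tends to a nonzero multiple of \<open>v > 0\<close>. Hence a positive solution exists on
  exactly one side of \<open>a\<close>, and the jump of \<open>aligned_below\<close> compensates for
  this.\<close>

lemma stable_aligned:
  assumes gen: "generic A" and reg: "regular_rhs A b" and a: "0 < a"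
    and v: "v \<noteq> 0" "\<forall>i. 0 \<le> v $ i" "pencil A T a *v v = 0"
  shows "parity_stable a (total_count A b T)"
proof -
  let ?d = "det_poly A T"
  have al: "aligned_trio A (1 / a) (sgn_mat T) (v /\<^sub>R norm v)"
    using aligned_trio_normalize[OF a v] .
  then have mem: "1 / a \<in> aligned_vals A T" by (auto simp: aligned_vals_def)
  obtain m where m: "?d = [:- a, 1:] * m" "poly m a \<noteq> 0"
    using generic_det_simple_root[OF gen a al] .
  have d0: "poly ?d a = 0" by (simp add: m)
  have nz: "\<forall>\<^sub>F t in at a. poly ?d t \<noteq> 0"
    by (rule eventually_poly_nonzero[OF det_poly_nonzero])
  have neq: "\<forall>\<^sub>F t in at a. t \<noteq> a" by (rule eventually_neq_at_within)
  \<comment> \<open>Cramer's rule is available only at nonsingular parameters, so the identity at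
    \<open>a\<close> is obtained as a limit.\<close>
  have "pencil A T a *v cramer_vec A b T a = poly ?d a *\<^sub>R b"
  proof (rule tendsto_eq_at)
    show "((\<lambda>t. pencil A T t *v cramer_vec A b T t) \<longlongrightarrow> pencil A T a *v cramer_vec A b T a) (at a)"
      by (intro continuous_pencil_apply tendsto_cramer_vec)
    show "((\<lambda>t. poly ?d t *\<^sub>R b) \<longlongrightarrow> poly ?d a *\<^sub>R b) (at a)"
      by (intro tendsto_intros tendsto_poly_at)
    show "\<forall>\<^sub>F t in at a. pencil A T t *v cramer_vec A b T t = poly ?d t *\<^sub>R b"
      using nz by eventually_elim (rule cramer_vec_solves)
  qed
  then obtain c where c: "cramer_vec A b T a = c *\<^sub>R v"
    using generic_kernel_line[OF gen a v] d0 by auto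
  \<comment> \<open>Otherwise \<open>t - a\<close> divides every Cramer polynomial. Dividing it out
    of both sides and letting \<open>t\<close> tend to \<open>a\<close> solves the singular system
    with right-hand side \<open>b\<close>, against regularity.\<close>
  have "c \<noteq> 0"
  proof
    assume "c = 0"
    then have "poly (cramer_poly A b T i) a = 0" for i
      using arg_cong[OF c, of "\<lambda>x. x $ i"] by (simp add: cramer_vec_def)
    then have "\<forall>i. \<exists>r. cramer_poly A b T i = [:- a, 1:] * r"
      unfolding poly_eq_0_iff_dvd dvd_def by blast
    then obtain r where r: "\<And>i. cramer_poly A b T i = [:- a, 1:] * r i" by metis
    define w where "w t = (\<chi> i. poly (r i) t)" for t
    have cw: "cramer_vec A b T t = (t - a) *\<^sub>R w t" for t
      by (simp add: cramer_vec_def w_def r vec_eq_iff algebra_simps)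
    have "pencil A T a *v w a = poly m a *\<^sub>R b"
    proof (rule tendsto_eq_at)
      show "((\<lambda>t. pencil A T t *v w t) \<longlongrightarrow> pencil A T a *v w a) (at a)"
        unfolding w_def by (intro continuous_pencil_apply tendsto_vec_lambda tendsto_poly_at)
      show "((\<lambda>t. poly m t *\<^sub>R b) \<longlongrightarrow> poly m a *\<^sub>R b) (at a)"
        by (intro tendsto_intros tendsto_poly_at)
      show "\<forall>\<^sub>F t in at a. pencil A T t *v w t = poly m t *\<^sub>R b"
        using nz neq
      proof eventually_elim
        case (elim t)
        have "(t - a) *\<^sub>R (pencil A T t *v w t) = poly ?d t *\<^sub>R b"
          using cramer_vec_solves[OF elim(1), of b] by (simp add: cw matrix_vector_mult_scaleR)
        also have "\<dots> = (t - a) *\<^sub>R (poly m t *\<^sub>R b)" by (simp add: m algebra_simps)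
        finally show ?case using elim(2) by (simp del: scaleR_scaleR)
      qed
    qed
    then have "pencil A T a *v ((1 / poly m a) *\<^sub>R w a) = b"
      using m(2) by (simp add: matrix_vector_mult_scaleR)
    with d0 reg show False unfolding regular_rhs_def by blast
  qed
  have pos: "0 < v $ i" for i using generic_kernel_pos[OF gen a v] .
  have ev1: "\<forall>\<^sub>F t in at a. \<forall>i. 0 < poly (cramer_poly A b T i) t * c"
  proof (rule eventually_all_finite)
    fix i
    have "poly (cramer_poly A b T i) a = c * v $ i"
      using arg_cong[OF c, of "\<lambda>x. x $ i"] by (simp add: cramer_vec_def)
    then have "poly (cramer_poly A b T i) a * c = c\<^sup>2 * v $ i"
      by (simp add: power2_eq_square)
    then have "0 < poly (cramer_poly A b T i) a * c"
      using pos[of i] \<open>c \<noteq> 0\<close> by simp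
    then show "\<forall>\<^sub>F t in at a. 0 < poly (cramer_poly A b T i) t * c"
      by (rule order_tendstoD(1)[rotated]) (intro tendsto_intros tendsto_poly_at)
  qed
  have "0 < poly m a * poly m a" using m(2) by (auto simp: zero_less_mult_iff neq_iff)
  then have ev2: "\<forall>\<^sub>F t in at a. 0 < poly m t * poly m a"
    by (rule order_tendstoD(1)[rotated]) (intro tendsto_intros tendsto_poly_at)
  \<comment> \<open>For \<open>c * poly m a > 0\<close> the solution lies on the right, where
    together with the jump it adds two. Otherwise it lies on the left, and exactly one is added on
    either side.\<close>
  have "\<forall>\<^sub>F t in at a. even (total_count A b T t) =
      (even (aligned_below A T a) = (0 < c * poly m a))"
    using ev1 ev2 neq aligned_below_jump[OF a mem]
  proof eventually_elim
    case (elim t)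
    have "0 < poly (cramer_poly A b T i) t * poly ?d t \<longleftrightarrow> 0 < (t - a) * (c * poly m a)" for i
    proof -
      have "poly ?d t = (t - a) * poly m t" by (simp add: m algebra_simps)
      then have "(poly (cramer_poly A b T i) t * poly ?d t) * ((t - a) * (c * poly m a)) =
          (poly (cramer_poly A b T i) t * c) * (poly m t * poly m a) * (t - a)\<^sup>2"
        by (simp add: power2_eq_square mult_ac)
      also have "0 < \<dots>"
        by (rule mult_pos_pos[OF mult_pos_pos]) (use elim(1-3) in auto)
      finally show ?thesis by (meson zero_less_mult_pos zero_less_mult_pos2)
    qed
    then have "pos_count A b T t = of_bool (0 < (t - a) * (c * poly m a))"
      by (simp add: pos_count_def)
    moreover have "c * poly m a \<noteq> 0" using \<open>c \<noteq> 0\<close> m(2) by simp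
    ultimately show ?case
      using elim(3,4)
      by (auto simp: total_count_def zero_less_mult_iff mult_less_0_iff of_bool_def not_less)
  qed
  then show ?thesis unfolding parity_stable_def by blast
qed

section \<open>Local constancy of the parity\<close>

lemma aligned_below_stable_regular:
  assumes "poly (det_poly A T) a \<noteq> 0"
  shows "\<forall>\<^sub>F t in at a. aligned_below A T t = aligned_below A T a"
proof (intro aligned_below_stable ballI notI)
  fix l assume "l \<in> aligned_vals A T" "l * a = 1"
  then obtain v where "v \<noteq> 0" "pencil A T a *v v = 0" by (rule aligned_vals_kernel)
  then show False using pencil_nonsingular[OF assms, of v 0] by simp
qed

lemma eventually_cramer_pos:
  assumes "poly (det_poly A T) a \<noteq> 0" "pencil A T a *v v = b" "0 < v $ i"
  shows "\<forall>\<^sub>F t in at a. 0 < poly (cramer_poly A b T i) t * poly (det_poly A T) t"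
proof -
  have "poly (cramer_poly A b T i) a = poly (det_poly A T) a * v $ i"
    using arg_cong[OF cramer_vec_eq[OF assms(2)], of "\<lambda>x. x $ i"] by (simp add: cramer_vec_def)
  then have "poly (cramer_poly A b T i) a * poly (det_poly A T) a = (poly (det_poly A T) a)\<^sup>2 * v $ i"
    by (simp add: power2_eq_square)
  then have "0 < poly (cramer_poly A b T i) a * poly (det_poly A T) a"
    using assms by simp
  then show ?thesis
    by (rule order_tendstoD(1)[rotated]) (intro tendsto_intros tendsto_poly_at)
qed

lemma stable_interior:
  assumes "poly (det_poly A T) a \<noteq> 0" "pencil A T a *v v = b" "\<forall>i. 0 < v $ i"
  shows "parity_stable a (total_count A b T)"
proof -
  have "\<forall>\<^sub>F t in at a. \<forall>i. 0 < poly (cramer_poly A b T i) t * poly (det_poly A T) t"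
    using assms by (intro eventually_all_finite eventually_cramer_pos[of A T a v]) auto
  with aligned_below_stable_regular[OF assms(1)]
  have "\<forall>\<^sub>F t in at a. total_count A b T t = 1 + aligned_below A T a"
    by eventually_elim (simp add: total_count_def pos_count_def)
  then show ?thesis by (rule parity_stableI)
qed

lemma cramer_poly_nonzero:
  assumes "b $ i \<noteq> 0"
  shows "cramer_poly A b T i \<noteq> 0"
  using cramer_poly_0[of A b T i] assms by auto

lemma pencil_flip:
  assumes "v $ i = 0"
  shows "pencil A (flip i T) t *v v = pencil A T t *v v"
  using assms by (simp add: pencil_mult vec_eq_iff sgn_mat_mult sgn_of_flip)

text \<open>Flipping the sign of a vanishing coordinate changes only column \<open>i\<close> of the pencil, so
  \<open>T\<close> and \<open>flip i T\<close> share the \<open>i\<close>-th Cramer polynomial. When it changes sign, one solution passes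
  from one orthant to the other if the determinants agree in sign; otherwise two solutions appear
  or disappear together.\<close>

lemma stable_facet_pair:
  assumes det: "poly (det_poly A T) a \<noteq> 0" "poly (det_poly A (flip i T)) a \<noteq> 0"
    and v: "pencil A T a *v v = b" "v $ i = 0" "\<And>j. j \<noteq> i \<Longrightarrow> 0 < v $ j"
    and b: "b $ i \<noteq> 0"
  shows "parity_stable a (\<lambda>t. total_count A b T t + total_count A b (flip i T) t)"
proof -
  let ?U = "flip i T" and ?d = "det_poly A T" and ?e = "det_poly A (flip i T)"
    and ?p = "cramer_poly A b T i"
  have vU: "pencil A ?U a *v v = b" using v by (simp add: pencil_flip)
  have ev1: "\<forall>\<^sub>F t in at a. \<forall>j. j \<noteq> i \<longrightarrow> 0 < poly (cramer_poly A b T j) t * poly ?d t"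
    using eventually_cramer_pos[OF det(1) v(1)] v(3)
    by (intro eventually_all_finite) (auto intro: eventually_mono)
  have ev2: "\<forall>\<^sub>F t in at a. \<forall>j. j \<noteq> i \<longrightarrow> 0 < poly (cramer_poly A b ?U j) t * poly ?e t"
    using eventually_cramer_pos[OF det(2) vU] v(3)
    by (intro eventually_all_finite) (auto intro: eventually_mono)
  have ev3: "\<forall>\<^sub>F t in at a. (0 < poly ?d t) = (0 < poly ?d a)"
    using det by (intro eventually_same_side tendsto_poly_at)
  have ev4: "\<forall>\<^sub>F t in at a. (0 < poly ?e t) = (0 < poly ?e a)"
    using det by (intro eventually_same_side tendsto_poly_at)
  have ev5: "\<forall>\<^sub>F t in at a. poly ?p t \<noteq> 0 \<and> poly ?d t \<noteq> 0 \<and> poly ?e t \<noteq> 0"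
    using b by (intro eventually_conj eventually_poly_nonzero det_poly_nonzero cramer_poly_nonzero)
  \<comment> \<open>With determinants of equal sign, \<open>T\<close> and \<open>flip i T\<close>
    are counted both or neither, so solutions appear or vanish in pairs. It is for opposite signs
    that exactly one is counted and the solution crosses the facet.\<close>
  have "\<forall>\<^sub>F t in at a. even (total_count A b T t + total_count A b ?U t) =
      (even (aligned_below A T a + aligned_below A ?U a) =
        ((0 < poly ?d a) = (0 < poly ?e a)))"
    using ev1 ev2 ev3 ev4 ev5 aligned_below_stable_regular[OF det(1)]
      aligned_below_stable_regular[OF det(2)]
  proof eventually_elim
    case (elim t)
    have "(\<forall>j. 0 < poly (cramer_poly A b T j) t * poly ?d t) \<longleftrightarrow> 0 < poly ?p t * poly ?d t"
      using elim(1) by metis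
    then have "pos_count A b T t = of_bool (0 < poly ?p t * poly ?d t)"
      by (simp add: pos_count_def)
    moreover have "(\<forall>j. 0 < poly (cramer_poly A b ?U j) t * poly ?e t) \<longleftrightarrow> 0 < poly ?p t * poly ?e t"
      using elim(2) cramer_poly_flip by metis
    then have "pos_count A b ?U t = of_bool (0 < poly ?p t * poly ?e t)"
      by (simp add: pos_count_def)
    ultimately show ?case
      using elim(3-) by (auto simp: total_count_def of_bool_def zero_less_mult_iff not_less)
  qed
  then show ?thesis unfolding parity_stable_def by blast
qed

text \<open>The involution \<open>flip i\<close> has no fixed points, so the sum splits into pairs,
  each represented by its member that omits \<open>i\<close>.\<close>

lemma parity_stable_sum_involution:
  fixes F :: "'n::finite set set"
  assumes "\<And>T. T \<in> F \<Longrightarrow> flip i T \<in> F"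
    and "\<And>T. T \<in> F \<Longrightarrow> parity_stable a (\<lambda>t. f T t + f (flip i T) t)"
  shows "parity_stable a (\<lambda>t. \<Sum>T\<in>F. f T t)"
proof -
  let ?G = "{T \<in> F. i \<notin> T}"
  have F: "F = ?G \<union> flip i ` ?G"
  proof (intro equalityI subsetI)
    fix T assume T: "T \<in> F"
    show "T \<in> ?G \<union> flip i ` ?G"
    proof (cases "i \<in> T")
      case True
      then have "flip i T \<in> ?G" using assms(1)[OF T] by (simp add: flip_def)
      then have "flip i (flip i T) \<in> flip i ` ?G" by (rule imageI)
      then show ?thesis by simp
    qed (use T in simp)
  qed (use assms(1) in auto)
  have "inj (flip i :: 'n set \<Rightarrow> 'n set)" by (metis flip_flip injI)
  then have inj: "inj_on (flip i) ?G" using inj_on_subset by blast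
  have "(\<Sum>T\<in>F. f T t) = (\<Sum>T\<in>?G. f T t) + (\<Sum>T\<in>flip i ` ?G. f T t)" for t
  proof -
    have "?G \<inter> flip i ` ?G = {}" by (auto simp: flip_def)
    then show ?thesis by (subst F, subst sum.union_disjoint) auto
  qed
  also have "\<And>t. (\<Sum>T\<in>?G. f T t) + (\<Sum>T\<in>flip i ` ?G. f T t) =
      (\<Sum>T\<in>?G. f T t + f (flip i T) t)"
    by (simp add: sum.reindex[OF inj] sum.distrib)
  finally have "(\<lambda>t. \<Sum>T\<in>F. f T t) = (\<lambda>t. \<Sum>T\<in>?G. f T t + f (flip i T) t)"
    by (rule ext)
  moreover have "parity_stable a (\<lambda>t. \<Sum>T\<in>?G. f T t + f (flip i T) t)"
    by (rule parity_stable_sum) (use assms(2) in auto)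
  ultimately show ?thesis by simp
qed

text \<open>Sign patterns whose solution touches a facet are handled in pairs. Each remaining
  pattern is stable by itself: it has no projective solution, one at infinity, or a strictly
  positive one.\<close>

lemma stable_total:
  fixes A :: "real^'n^'n"
  assumes gen: "generic A" and reg: "regular_rhs A b" and a: "0 \<le> a"
  shows "parity_stable a (\<lambda>t. \<Sum>T\<in>UNIV. total_count A b T t)"
proof -
  \<comment> \<open>A solution with vanishing \<open>i\<close>-th coordinate also solves the flipped
    system, so \<open>F i\<close> is closed under \<open>flip i\<close>. Regularity makes these
    families disjoint.\<close>
  define F where "F i = {T. \<exists>v. pencil A T a *v v = b \<and> (\<forall>j. 0 \<le> v $ j) \<and> v $ i = 0}" for i
  have nonsing: "poly (det_poly A T) a \<noteq> 0" if "pencil A T a *v v = b" for T v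
    using that reg unfolding regular_rhs_def by blast
  have two: "i = j" if "pencil A T a *v v = b" "v $ i = 0" "v $ j = 0" for T v i j
    using that reg unfolding regular_rhs_def by blast
  have disj: "F i \<inter> F j = {}" if "i \<noteq> j" for i j
  proof (rule ccontr)
    assume "F i \<inter> F j \<noteq> {}"
    then obtain T v w where *: "pencil A T a *v v = b" "v $ i = 0" "pencil A T a *v w = b" "w $ j = 0"
      by (auto simp: F_def)
    then have "v = w" by (metis nonsing pencil_nonsingular)
    with * two that show False by blast
  qed
  have "parity_stable a (\<lambda>t. \<Sum>T\<in>F i. total_count A b T t)" for i
  proof (rule parity_stable_sum_involution[of _ i])
    fix T assume "T \<in> F i"
    then obtain v where v: "pencil A T a *v v = b" "\<forall>j. 0 \<le> v $ j" "v $ i = 0"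
      by (auto simp: F_def)
    have vU: "pencil A (flip i T) a *v v = b" using v by (simp add: pencil_flip)
    then show "flip i T \<in> F i" using v by (auto simp: F_def)
    have "0 < v $ j" if "j \<noteq> i" for j
      using two[OF v(1,3), of j] v(2) that by (metis order_less_le)
    then show "parity_stable a (\<lambda>t. total_count A b T t + total_count A b (flip i T) t)"
      using reg unfolding regular_rhs_def
      by (intro stable_facet_pair[of A T a i v b] nonsing[OF v(1)] nonsing[OF vU] v) auto
  qed
  then have facets: "parity_stable a (\<lambda>t. \<Sum>i\<in>UNIV. \<Sum>T\<in>F i. total_count A b T t)"
    by (rule parity_stable_sum[OF finite])
  have rest: "parity_stable a (\<lambda>t. \<Sum>T\<in>-(\<Union>i. F i). total_count A b T t)"
  proof (rule parity_stable_sum)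
    fix T assume T: "T \<in> -(\<Union>i. F i)"
    show "parity_stable a (total_count A b T)"
    proof (cases "(a, b) \<in> nonneg_solvable A T")
      case True
      then obtain v h where v: "\<forall>i. 0 \<le> v $ i" "0 \<le> h" "v \<noteq> 0 \<or> h \<noteq> 0"
        "pencil A T a *v v = h *\<^sub>R b" by (rule nonneg_solvableE)
      show ?thesis
      proof (cases "h = 0")
        case True
        then have "v \<noteq> 0" "pencil A T a *v v = 0" using v by auto
        moreover have "a \<noteq> 0"
        proof
          assume "a = 0"
          then have "sgn_mat T *v v = 0" using v True by (simp add: pencil_mult)
          then have "v = 0" by (simp add: sgn_mat_mult_eq_iff)
          then show False using \<open>v \<noteq> 0\<close> by simp
        qed
        ultimately show ?thesis using stable_aligned[OF gen reg, of a v T] a v(1) by simp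
      next
        case False
        define w where "w = (1 / h) *\<^sub>R v"
        have w: "pencil A T a *v w = b" "\<forall>i. 0 \<le> w $ i"
          using v False by (auto simp: w_def matrix_vector_mult_scaleR)
        then have "w $ i \<noteq> 0" for i using T by (auto simp: F_def)
        then have "\<forall>i. 0 < w $ i" using w(2) by (simp add: order_less_le)
        then show ?thesis using stable_interior[OF nonsing[OF w(1)] w(1)] by simp
      qed
    qed (rule stable_unsolvable)
  qed simp
  have "(\<Sum>T\<in>UNIV. total_count A b T t) =
      (\<Sum>T\<in>-(\<Union>i. F i). total_count A b T t) + (\<Sum>i\<in>UNIV. \<Sum>T\<in>F i. total_count A b T t)" for t
  proof -
    have "(\<Sum>T\<in>UNIV. total_count A b T t) =
        (\<Sum>T\<in>-(\<Union>i. F i) \<union> (\<Union>i. F i). total_count A b T t)"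
      by (simp only: Compl_partition2)
    also have "\<dots> = (\<Sum>T\<in>-(\<Union>i. F i). total_count A b T t) + (\<Sum>T\<in>(\<Union>i. F i). total_count A b T t)"
      by (rule sum.union_disjoint) auto
    also have "(\<Sum>T\<in>(\<Union>i. F i). total_count A b T t) = (\<Sum>i\<in>UNIV. \<Sum>T\<in>F i. total_count A b T t)"
      by (rule sum.UNION_disjoint) (use disj in auto)
    finally show ?thesis .
  qed
  then show ?thesis using parity_stable_add[OF rest facets] by simp
qed

text \<open>The parity near a point is a locally constant function of that point, hence constant on
  a connected set. For \<open>z\<close> other than \<open>y\<close>, removing \<open>y\<close> from
  a neighbourhood of \<open>y\<close> leaves a neighbourhood of \<open>z\<close>.\<close>

lemma parity_stable_constant:
  assumes S: "connected S" "a \<in> S" "x \<in> S" and stable: "\<And>x. x \<in> S \<Longrightarrow> parity_stable x f"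
    and a: "\<forall>\<^sub>F t in at a. odd (f t)"
  shows "\<forall>\<^sub>F t in at x. odd (f t)"
proof -
  define c where "c x = (\<forall>\<^sub>F t in at x. odd (f t))" for x
  have "\<exists>U. openin (top_of_set S) U \<and> y \<in> U \<and> (\<forall>z\<in>U. c z = c y)" if y: "y \<in> S" for y
  proof -
    obtain d where "\<forall>\<^sub>F t in at y. even (f t) = d"
      using stable[OF y] unfolding parity_stable_def by blast
    then obtain U where U: "open U" "y \<in> U" "\<And>t. t \<in> U \<Longrightarrow> t \<noteq> y \<Longrightarrow> even (f t) = d"
      unfolding eventually_at_topological by auto
    have "c z = (\<not> d)" if z: "z \<in> U" for z
    proof -
      have "\<forall>\<^sub>F t in at z. even (f t) = d"
      proof (cases "z = y")
        case True
        then show ?thesis unfolding eventually_at_topological using U by blast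
      next
        case False
        then show ?thesis unfolding eventually_at_topological
          using U z by (intro exI[of _ "U - {y}"]) auto
      qed
      then have "c z \<longleftrightarrow> (\<forall>\<^sub>F t in at z. \<not> d)"
        unfolding c_def by (intro eventually_subst) (auto elim: eventually_mono)
      then show ?thesis by simp
    qed
    then show ?thesis
      using U y by (intro exI[of _ "S \<inter> U"]) (auto simp: openin_open)
  qed
  then have "c constant_on S"
    using locally_constant_imp_constant[OF S(1)] by blast
  then have "c x = c a" using S unfolding constant_on_def by metis
  with a show ?thesis by (simp add: c_def)
qed

text \<open>At \<open>t = 0\<close> the solution for pattern \<open>T\<close> is
  \<open>sgn_mat T *v b\<close>, positive only when \<open>T\<close> is the set of negative
  coordinates of \<open>b\<close>. All relevant quantities are nonzero there, so their signs persist
  nearby.\<close>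

lemma total_count_at_0:
  fixes A :: "real^'n^'n"
  assumes "regular_rhs A b"
  shows "\<forall>\<^sub>F t in at 0. (\<Sum>T\<in>UNIV. total_count A b T t) = 1"
proof -
  have b: "b $ i \<noteq> 0" for i using assms by (simp add: regular_rhs_def)
  let ?B = "{i. b $ i < 0}"
  have val: "poly (cramer_poly A b T i) 0 * poly (det_poly A T) 0 = sgn_of T i * b $ i" for T i
  proof -
    have "poly (cramer_poly A b T i) 0 * poly (det_poly A T) 0 =
        (det (sgn_mat T :: real^'n^'n) * det (sgn_mat T :: real^'n^'n)) * (sgn_of T i * b $ i)"
      unfolding cramer_poly_0 det_poly_0 by (simp only: mult_ac)
    then show ?thesis by (simp add: det_sgn_mat_square)
  qed
  have "\<forall>\<^sub>F t in at 0. \<forall>T i. (0 < poly (cramer_poly A b T i) t * poly (det_poly A T) t) =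
      (0 < poly (cramer_poly A b T i) 0 * poly (det_poly A T) 0)"
  proof (intro eventually_all_finite eventually_same_side tendsto_mult tendsto_poly_at)
    show "poly (cramer_poly A b T i) 0 * poly (det_poly A T) 0 \<noteq> 0" for T i
      unfolding val using b by simp
  qed
  moreover have "\<forall>\<^sub>F t in at 0. \<forall>T. aligned_below A T t = aligned_below A T 0"
    by (intro eventually_all_finite aligned_below_stable_regular) (simp add: det_poly_0)
  ultimately show ?thesis
  proof eventually_elim
    case (elim t)
    have "total_count A b T t = of_bool (T = ?B)" for T
    proof -
      have "(\<forall>i. 0 < sgn_of T i * b $ i) \<longleftrightarrow> T = ?B"
      proof
        assume "\<forall>i. 0 < sgn_of T i * b $ i"
        then have "i \<in> T \<longleftrightarrow> b $ i < 0" for i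
          by (auto simp: sgn_of_def split: if_splits dest: spec[of _ i])
        then show "T = ?B" by blast
      next
        assume "T = ?B"
        then show "\<forall>i. 0 < sgn_of T i * b $ i" using b by (auto simp: sgn_of_def order_less_le)
      qed
      then show ?thesis
        using elim by (simp add: total_count_def pos_count_def val) (simp add: aligned_below_def)
    qed
    then show ?case by simp
  qed
qed

section \<open>From regular to arbitrary right-hand sides\<close>

lemma finite_aligned_spectrum: "finite (aligned_spectrum A)"
  and aligned_spectrum_eq: "aligned_spectrum A = (\<Union>T. aligned_vals A T)"
proof -
  show *: "aligned_spectrum A = (\<Union>T. aligned_vals A T)"
  proof (intro equalityI subsetI)
    fix l assume "l \<in> aligned_spectrum A"
    then obtain S v where al: "aligned_trio A l S v" by (auto simp: aligned_spectrum_def)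
    then have "S \<in> range sgn_mat"
      using bij_betw_imp_surj_on[OF bij_sgn_mat] by (auto simp: aligned_trio_def)
    then show "l \<in> (\<Union>T. aligned_vals A T)" using al by (auto simp: aligned_vals_def)
  qed (auto simp: aligned_spectrum_def aligned_vals_def)
  show "finite (aligned_spectrum A)"
    unfolding * by (intro finite_UN_I finite_aligned_vals) simp
qed

text \<open>The kernel of the pencil is a line spanned by a positive vector, and such a line
  contains only one nonnegative unit vector.\<close>

lemma aligned_vector_unique:
  fixes A :: "real^'n^'n"
  assumes "generic A" "0 < l" "aligned_trio A l (sgn_mat T) v" "aligned_trio A l (sgn_mat T) w"
  shows "v = w"
proof -
  have t: "0 < 1 / l" and l: "l = 1 / (1 / l)" using assms(2) by simp_all
  have v: "\<forall>i. 0 \<le> v $ i" "norm v = 1" "pencil A T (1 / l) *v v = 0"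
    using assms(3) aligned_trio_iff_pencil[OF t, of A T v] by simp_all
  have w: "\<forall>i. 0 \<le> w $ i" "norm w = 1" "pencil A T (1 / l) *v w = 0"
    using assms(4) aligned_trio_iff_pencil[OF t, of A T w] by simp_all
  have nz: "v \<noteq> 0" using v(2) by auto
  obtain c where c: "w = c *\<^sub>R v"
    using generic_kernel_line[OF assms(1) t nz v(1,3) w(3)] by blast
  obtain i :: 'n where True by simp
  have "0 < v $ i" using generic_kernel_pos[OF assms(1) t nz v(1,3)] .
  moreover have "0 \<le> c * v $ i" using w(1) by (simp add: c)
  ultimately have "0 \<le> c" by (simp add: zero_le_mult_iff)
  then have "c = 1" using v(2) w(2) by (simp add: c)
  then show ?thesis using c by simp
qed

text \<open>Since the vector is determined by the sign matrix, counting pairs amounts to counting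
  sign patterns.\<close>

lemma aligned_multiplicity_eq:
  fixes A :: "real^'n^'n"
  assumes "generic A" "0 < l"
  shows "aligned_multiplicity A l = card {T. l \<in> aligned_vals A T}"
proof -
  define g :: "'n set \<Rightarrow> (real^'n^'n) \<times> (real^'n)"
    where "g T = (sgn_mat T, SOME v. aligned_trio A l (sgn_mat T) v)" for T
  have g: "aligned_trio A l (sgn_mat T) v \<Longrightarrow> g T = (sgn_mat T, v)" for T v
    unfolding g_def using aligned_vector_unique[OF assms] by (auto intro: someI2)
  have "inj (sgn_mat :: 'n set \<Rightarrow> real^'n^'n)"
    using bij_betw_imp_inj_on[OF bij_sgn_mat] .
  then have "inj_on g {T. l \<in> aligned_vals A T}"
    by (auto simp: inj_on_def g_def)
  moreover have "g ` {T. l \<in> aligned_vals A T} = {(S, v). aligned_trio A l S v}"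
  proof (intro equalityI subsetI)
    fix y assume "y \<in> {(S, v). aligned_trio A l S v}"
    then obtain S v where y: "y = (S, v)" "aligned_trio A l S v" by auto
    then obtain T where "S = sgn_mat T"
      using bij_betw_imp_surj_on[OF bij_sgn_mat] by (auto simp: aligned_trio_def)
    then show "y \<in> g ` {T. l \<in> aligned_vals A T}"
      using y g[of T v] by (auto simp: aligned_vals_def intro!: image_eqI[of _ _ T])
  next
    fix y assume "y \<in> g ` {T. l \<in> aligned_vals A T}"
    then obtain T v where "y = g T" "aligned_trio A l (sgn_mat T) v"
      by (auto simp: aligned_vals_def)
    then show "y \<in> {(S, v). aligned_trio A l S v}" by (simp add: g)
  qed
  ultimately show ?thesis
    unfolding aligned_multiplicity_def by (metis card_image)
qed

text \<open>Double counting of pairs of a pattern and an aligned value; this identifies the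
  correction term at \<open>t = 1\<close> with the count whose parity is assumed even.\<close>

lemma aligned_count_eq:
  assumes "generic A"
  shows "aligned_count A = (\<Sum>T\<in>UNIV. aligned_below A T 1)"
proof -
  let ?L = "{l \<in> aligned_spectrum A. 1 < l}"
  have fin: "finite ?L" by (simp add: finite_aligned_spectrum)
  have "aligned_count A = (\<Sum>l\<in>?L. card {T. l \<in> aligned_vals A T})"
    unfolding aligned_count_def
    by (intro sum.cong refl aligned_multiplicity_eq assms) auto
  also have "\<dots> = (\<Sum>l\<in>?L. \<Sum>T\<in>UNIV. of_bool (l \<in> aligned_vals A T))"
    by simp
  also have "\<dots> = (\<Sum>T\<in>UNIV. \<Sum>l\<in>?L. of_bool (l \<in> aligned_vals A T))"
    by (rule sum.swap)
  also have "\<dots> = (\<Sum>T\<in>UNIV. aligned_below A T 1)"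
  proof (intro sum.cong refl)
    fix T
    have "?L \<inter> {l. l \<in> aligned_vals A T} = {l \<in> aligned_vals A T. 1 < l * 1}"
      by (auto simp: aligned_spectrum_eq)
    then show "(\<Sum>l\<in>?L. of_bool (l \<in> aligned_vals A T)) = aligned_below A T 1"
      using fin by (simp add: aligned_below_def)
  qed
  finally show ?thesis .
qed

text \<open>Without a solution at \<open>t = 1\<close> there is none nearby, so the total near 1 is
  the even aligned count. The parity carried over from \<open>t = 0\<close> is odd.\<close>

lemma regular_rhs_solvable:
  assumes gen: "generic A" and spec: "1 \<notin> aligned_spectrum A" and ev: "even (aligned_count A)"
    and reg: "regular_rhs A b"
  shows "(1, b) \<in> (\<Union>T. nonneg_solvable A T)"
proof (rule ccontr)
  assume unsolv: "(1, b) \<notin> (\<Union>T. nonneg_solvable A T)"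
  have "\<forall>\<^sub>F t in at 1. \<forall>T. aligned_below A T t = aligned_below A T 1"
    using spec by (intro eventually_all_finite aligned_below_stable) (auto simp: aligned_spectrum_eq)
  moreover have "\<forall>\<^sub>F t in at 1. \<forall>T. pos_count A b T t = 0"
    using unsolv by (intro eventually_all_finite eventually_pos_count_0) auto
  ultimately have "\<forall>\<^sub>F t in at 1. even (\<Sum>T\<in>UNIV. total_count A b T t)"
    by eventually_elim (use ev in \<open>simp add: total_count_def aligned_count_eq[OF gen]\<close>)
  then obtain d where d: "0 < d" "\<And>t. t \<noteq> 1 \<Longrightarrow> dist t 1 < d \<Longrightarrow> even (\<Sum>T\<in>UNIV. total_count A b T t)"
    unfolding eventually_at by auto
  \<comment> \<open>A point of \<open>{0..<1}\<close> closer to 1 than \<open>d\<close>, where both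
    parities can be compared; the minimum keeps it nonnegative.\<close>
  define a where "a = 1 - min d 1 / 2"
  have a: "0 \<le> a" "a < 1" "dist a 1 < d" using d(1) by (auto simp: a_def dist_real_def)
  have "\<forall>\<^sub>F t in at a. t < 1 \<and> dist t 1 < d"
  proof (rule eventually_conj)
    show "\<forall>\<^sub>F t in at a. t < 1" by (rule order_tendstoD(2)[OF tendsto_ident_at a(2)])
    have "((\<lambda>t. dist t 1) \<longlongrightarrow> dist a 1) (at a)" by (intro tendsto_intros)
    then show "\<forall>\<^sub>F t in at a. dist t 1 < d" using a(3) by (rule order_tendstoD(2))
  qed
  then have "\<forall>\<^sub>F t in at a. even (\<Sum>T\<in>UNIV. total_count A b T t)"
    by eventually_elim (use d(2) in auto)
  moreover have "\<forall>\<^sub>F t in at a. odd (\<Sum>T\<in>UNIV. total_count A b T t)"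
  proof (rule parity_stable_constant[of "{0..<1}" 0 a])
    show "\<forall>\<^sub>F t in at 0. odd (\<Sum>T\<in>UNIV. total_count A b T t)"
      using total_count_at_0[OF reg] by eventually_elim simp
  qed (use a stable_total[OF gen reg] in auto)
  ultimately have "\<forall>\<^sub>F t in at a. False" by eventually_elim blast
  then show False by simp
qed

section \<open>Null sets of irregular right-hand sides\<close>

lemma negligible_singular_rhs:
  fixes A :: "real^'n^'n"
  assumes "poly (det_poly A T) t = 0"
  shows "negligible (range (\<lambda>v. pencil A T t *v v))"
proof (rule negligible_linear_singular_image)
  obtain x where "x \<noteq> 0" "pencil A T t *v x = 0" using pencil_singular[OF assms] .
  then show "\<not> inj (\<lambda>v. pencil A T t *v v)"
    by (metis injD matrix_vector_mult_0_right)
qed simp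

text \<open>The coordinate \<open>z $ i\<close>, which does not enter the vector, is used to store the parameter.\<close>

lemma negligible_codim_two_rhs:
  fixes A :: "real^'n^'n"
  assumes "i \<noteq> j"
  shows "negligible {b. \<exists>t v. pencil A T t *v v = b \<and> v $ i = 0 \<and> v $ j = 0}"
proof -
  define g where "g z = z - (z $ i) *\<^sub>R axis i 1" for z :: "real^'n"
  define f where "f z = pencil A T (z $ i) *v g z" for z :: "real^'n"
  have "bounded_linear g"
    unfolding g_def
    by (intro bounded_linear_sub bounded_linear_ident bounded_linear_scaleR_left
        bounded_linear_compose[OF bounded_linear_scaleR_left bounded_linear_vec_nth])
  then have lin: "bounded_linear (\<lambda>z. M *v g z)" for M :: "real^'n^'n"
    by (rule bounded_linear_compose[OF matrix_vector_mul_bounded_linear])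
  have "f differentiable (at z)" for z
    unfolding f_def pencil_mult
    by (intro differentiable_diff differentiable_scaleR bounded_linear_imp_differentiable lin
        bounded_linear_vec_nth)
  then have "f differentiable_on {z. z $ j = 0}"
    by (simp add: differentiable_at_imp_differentiable_on)
  \<comment> \<open>Two coordinates vanish and one parameter is added, so a hyperplane parametrizes
    the set; differentiable maps of the space to itself preserve null sets.\<close>
  then have "negligible (f ` {z. z $ j = 0})"
    by (intro negligible_differentiable_image_negligible negligible_standard_hyperplane_cart) auto
  moreover have "{b. \<exists>t v. pencil A T t *v v = b \<and> v $ i = 0 \<and> v $ j = 0} \<subseteq> f ` {z. z $ j = 0}"
  proof clarify
    fix t and v :: "real^'n" assume v: "v $ i = 0" "v $ j = 0"
    let ?z = "v + t *\<^sub>R axis i 1"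
    have "?z $ i = t" "?z $ j = 0" using v assms by (simp_all add: axis_def)
    moreover from this have "g ?z = v" by (simp add: g_def)
    ultimately show "pencil A T t *v v \<in> f ` {z. z $ j = 0}"
      by (intro image_eqI[of _ _ ?z]) (auto simp: f_def)
  qed
  ultimately show ?thesis by (rule negligible_subset)
qed

lemma negligible_irregular_rhs:
  fixes A :: "real^'n^'n"
  shows "negligible {b. \<not> regular_rhs A b}"
proof (rule negligible_subset)
  let ?X = "(\<Union>i. {b :: real^'n. b $ i = 0})"
  let ?Y = "(\<Union>T. \<Union>t\<in>{t. poly (det_poly A T) t = 0}. range (\<lambda>v. pencil A T t *v v))"
  let ?Z = "(\<Union>T. \<Union>(i, j)\<in>{(i, j). i \<noteq> j}. {b. \<exists>t v. pencil A T t *v v = b \<and> v $ i = 0 \<and> v $ j = 0})"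
  have fin: "finite {t. poly (det_poly A T) t = 0}" for T
    by (rule poly_roots_finite[OF det_poly_nonzero])
  have "negligible ?X"
    by (intro negligible_Union) (auto intro: negligible_standard_hyperplane_cart)
  moreover have "negligible ?Y"
    by (intro negligible_Union) (auto intro!: negligible_Union finite_imageI fin negligible_singular_rhs)
  moreover have "negligible ?Z"
    by (intro negligible_Union) (auto intro!: negligible_Union intro: negligible_codim_two_rhs)
  ultimately show "negligible (?X \<union> ?Y \<union> ?Z)" by (intro negligible_Un)
  show "{b. \<not> regular_rhs A b} \<subseteq> ?X \<union> ?Y \<union> ?Z"
    unfolding regular_rhs_def by fast
qed

text \<open>The right-hand sides without a projective solution form an open set consisting of
  irregular ones; an open null set is empty.\<close>

lemma nonneg_solvable_1:
  assumes gen: "generic A" and spec: "1 \<notin> aligned_spectrum A" and ev: "even (aligned_count A)"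
  shows "(1, b) \<in> (\<Union>T. nonneg_solvable A T)"
proof -
  let ?N = "\<Union>T. nonneg_solvable A T"
  have "closed ?N" by (intro closed_UN) (auto intro: closed_nonneg_solvable)
  then have "closed ((\<lambda>b. (1, b)) -` ?N)"
    by (rule continuous_closed_vimage) (intro continuous_intros)
  then have op: "open {b. (1, b) \<notin> ?N}"
    unfolding closed_def vimage_def by (simp add: Compl_eq)
  have "{b. (1, b) \<notin> ?N} \<subseteq> {b. \<not> regular_rhs A b}"
    using regular_rhs_solvable[OF assms] by blast
  then have "negligible {b. (1, b) \<notin> ?N}"
    using negligible_irregular_rhs negligible_subset by blast
  then have "{b. (1, b) \<notin> ?N} = {}" using op open_not_negligible by blast
  then show ?thesis by blast
qed

theorem corollary1p3:
  fixes A :: "real^'n^'n"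
  assumes "generic A"
    and "1 \<notin> aligned_spectrum A"
    and "even (aligned_count A)"
  shows "\<forall>b :: real^'n. \<exists>z :: real^'n. z - A *v \<bar>z\<bar> = b"
proof
  fix b :: "real^'n"
  obtain T where "(1, b) \<in> nonneg_solvable A T" using nonneg_solvable_1[OF assms] by blast
  then obtain v h where v: "\<forall>i. 0 \<le> v $ i" "0 \<le> h" "v \<noteq> 0 \<or> h \<noteq> 0"
    "pencil A T 1 *v v = h *\<^sub>R b" by (rule nonneg_solvableE)
  \<comment> \<open>A solution at infinity for \<open>t = 1\<close> would, after normalization, make
    1 an aligned value.\<close>
  have "h \<noteq> 0"
  proof
    assume "h = 0"
    then have "aligned_trio A (1 / 1) (sgn_mat T) (v /\<^sub>R norm v)"
      using v by (intro aligned_trio_normalize) auto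
    with assms(2) show False by (auto simp: aligned_spectrum_def)
  qed
  \<comment> \<open>Applying the sign matrix changes only signs, so the absolute value recovers the
    nonnegative vector \<open>v / h\<close>.\<close>
  define z where "z = (1 / h) *\<^sub>R (sgn_mat T *v v)"
  have "\<bar>z\<bar> = (1 / h) *\<^sub>R v"
    using v(1,2) by (simp add: z_def abs_vec_def vec_eq_iff sgn_mat_mult abs_mult)
  then have "z - A *v \<bar>z\<bar> = (1 / h) *\<^sub>R (pencil A T 1 *v v)"
    by (simp add: z_def pencil_mult matrix_vector_mult_scaleR scaleR_diff_right)
  also have "\<dots> = b" using \<open>h \<noteq> 0\<close> by (simp add: v(4))
  finally show "\<exists>z. z - A *v \<bar>z\<bar> = b" by blast
qed

end
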